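(* Let $P$ be a transition matrix on a countable state space $S$, let $\{A_i : i\in I\}$ be a countable collection of subsets of $S$, and let $\mu\leq_{\mathrm{germ}}\nu$ be two offspring distributions. Let $(B_n)_{n\ge 0}$ be a branching Markov process and let $I_\infty=\{i\in I : A_i \text{ is visited infinitely often by } B\}$. 1. If $I_\infty$ is infinite $\mathbf{P}_x^\mu$-almost surely on the event $\Omega_\infty$ for every $x\in S$, then $I_\infty$ is also infinite $\mathbf{P}_x^\nu$-almost surely on the event $\Omega_\infty$ for every $x\in S$. 2. If $I_\infty$ is finite $\mathbf{P}_x^\nu$-almost surely for every $x\in S$, then $I_\infty$ is also finite $\mathbf{P}_x^\mu$-almost surely for every $x\in S$.
   Context: $S$ is a countable set and $P$ is the transition matrix of a Markov chain on $S$. An offspring distribution is a probability measure on $\{0,1,2,\ldots\}$. For a probability measure $\mu$ on $[0,\infty)$, its probability generating function is $\mathcal{P}_\mu(t)=\int_0^\infty t^x\,d\mu(x)$ for $t\in[0,1]$. The germ order on probability measures on $[0,\infty)$ is defined by: $\mu\leq_{\mathrm{germ}}\nu$ if and only if there exists $\varepsilon>0$ such that $\mathcal{P}_\mu(t)\ge\mathcal{P}_\nu(t)$ for every $1-\varepsilon\le t\le 1$. The branching Markov process $(B_n)_{n\ge 0}$ associated to $(P,\mu)$ takes values in finitely supported functions $S\to\{0,1,2,\ldots\}$, where $B_n(y)$ is the number of particles at state $y$ at time $n$. It starts from a single particle at some $x\in S$. At each time step, each particle independently splits into a random number of new particles with law $\mu$, and each new particle immediately performs an independent step of the Markov chain with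 transition matrix $P$ from its parent's location. The law of this process started from a single particle at $x$ is denoted $\mathbf{P}_x^\mu$ (and $\mathbf{P}_x^\nu$ when the offspring distribution is $\nu$). A set $A\subseteq S$ is visited infinitely often by $B$ if $L(A)=\sum_{a\in A}\sum_{n\ge 0}B_n(a)=\infty$. $\Omega_\infty$ is the event that the process survives forever, i.e. $\sum_{y\in S}B_n(y)>0$ for every $n\ge 0$.
   Formalization: Item 1 is stated under the additional assumption that the event Ω_∞ has positive P_x^μ-probability for some x; without it item 1 fails, e.g. for μ = δ_0, ν = δ_2 and all A_i empty. *)

theory Defs
  imports "HOL-Probability.Probability"
begin

section \<open>The germ order\<close>

text \<open>Measures on \<open>[0,\<infinity>)\<close> are measures on the reals that are concentrated on \<open>[0,\<infinity>)\<close>.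
  The case distinction implements the convention \<open>0\<^sup>0 = 1\<close>, since \<^term>\<open>(0::real) powr 0 = 0\<close>.\<close>

definition pgf :: "real measure \<Rightarrow> real \<Rightarrow> real" where
  "pgf \<mu> t = (\<integral>x. (if x = 0 then 1 else t powr x) \<partial>\<mu>)"

definition germ_le :: "real measure \<Rightarrow> real measure \<Rightarrow> bool"  (infix \<open>\<le>\<^sub>g\<^sub>e\<^sub>r\<^sub>m\<close> 50) where
  "\<mu> \<le>\<^sub>g\<^sub>e\<^sub>r\<^sub>m \<nu> \<longleftrightarrow> (\<exists>\<epsilon>>0. \<forall>t\<in>{0..1}. 1 - \<epsilon> \<le> t \<longrightarrow> pgf \<mu> t \<ge> pgf \<nu> t)"

text \<open>An offspring distribution, seen as a measure on \<open>[0,\<infinity>)\<close>.\<close>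

definition offspring_measure :: "nat pmf \<Rightarrow> real measure" where
  "offspring_measure \<mu> = distr (measure_pmf \<mu>) borel real"

lemma pgf_offspring_measure:
  assumes "0 \<le> t"
  shows "pgf (offspring_measure \<mu>) t = measure_pmf.expectation \<mu> (\<lambda>k. t ^ k)"
proof -
  have eq: "(if real k = 0 then 1 else t powr real k) = t ^ k" for k :: nat
    using assms by (cases "t = 0") (auto simp: powr_realpow)
  have "pgf (offspring_measure \<mu>) t =
     measure_pmf.expectation \<mu> (\<lambda>k. if real k = 0 then 1 else t powr real k)"
    unfolding pgf_def offspring_measure_def by (rule integral_distr) measurable
  then show ?thesis
    unfolding eq .
qed

section \<open>Branching Markov processes\<close>

text \<open>Finitely supported functions from the state space to the natural numbers are multisets:
  \<^term>\<open>count M y\<close> is the number of particles at \<^term>\<open>y\<close>. Transition matrices are functions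
  \<open>P :: 's \<Rightarrow> 's pmf\<close>, with \<^term>\<open>pmf (P x) y\<close> the entry at \<open>(x, y)\<close>.\<close>

definition brood :: "('s \<Rightarrow> 's pmf) \<Rightarrow> nat pmf \<Rightarrow> 's \<Rightarrow> 's multiset pmf" where
  "brood P \<mu> x = bind_pmf \<mu> (\<lambda>k. map_pmf mset (replicate_pmf k (P x)))"

text \<open>The law of the sum of two independent random configurations.\<close>

definition superpose :: "'s multiset pmf \<Rightarrow> 's multiset pmf \<Rightarrow> 's multiset pmf" where
  "superpose p q = map_pmf (\<lambda>(M, N). M + N) (pair_pmf p q)"

definition bmp_step :: "('s \<Rightarrow> 's pmf) \<Rightarrow> nat pmf \<Rightarrow> 's multiset \<Rightarrow> 's multiset pmf" where
  "bmp_step P \<mu> M = fold_mset (\<lambda>x p. superpose (brood P \<mu> x) p) (return_pmf {#}) M"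

lemma superpose_left_commute: "superpose p (superpose q r) = superpose q (superpose p r)"
proof -
  have *: "superpose p q = bind_pmf p (\<lambda>x. bind_pmf q (\<lambda>y. return_pmf (x + y)))"
    for p q :: "'a multiset pmf"
    by (simp add: superpose_def pair_pmf_def map_bind_pmf map_return_pmf)
  show ?thesis
    unfolding * bind_assoc_pmf bind_return_pmf
    by (subst bind_commute_pmf) (simp add: add.left_commute)
qed

lemma bmp_step_empty [simp]: "bmp_step P \<mu> {#} = return_pmf {#}"
  by (simp add: bmp_step_def)

lemma bmp_step_add_mset [simp]:
  "bmp_step P \<mu> (add_mset x M) = superpose (brood P \<mu> x) (bmp_step P \<mu> M)"
proof -
  interpret comp_fun_commute "\<lambda>x p. superpose (brood P \<mu> x) p"
    by standard (rule ext, simp only: o_apply, rule superpose_left_commute)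
  show ?thesis
    unfolding bmp_step_def by (rule fold_mset_add_mset)
qed

text \<open>The conditional law of the \<open>n\<close>-th configuration given the previous ones, for the process
  started from a single particle at \<open>x\<close>, and the resulting law of the whole trajectory
  (by the Ionescu-Tulcea theorem).\<close>

definition bmp_kernel ::
  "('s \<Rightarrow> 's pmf) \<Rightarrow> nat pmf \<Rightarrow> 's \<Rightarrow> nat \<Rightarrow> (nat \<Rightarrow> 's multiset) \<Rightarrow> 's multiset measure" where
  "bmp_kernel P \<mu> x n B =
     measure_pmf (if n = 0 then return_pmf {#x#} else bmp_step P \<mu> (B (n - 1)))"

definition bmp_law ::
  "('s \<Rightarrow> 's pmf) \<Rightarrow> nat pmf \<Rightarrow> 's \<Rightarrow> (nat \<Rightarrow> 's multiset) measure" where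
  "bmp_law P \<mu> x =
     projective_family.lim UNIV (Ionescu_Tulcea.CI (bmp_kernel P \<mu> x) (\<lambda>_. count_space UNIV))
       (\<lambda>_. count_space UNIV)"

lemma Ionescu_Tulcea_bmp: "Ionescu_Tulcea (bmp_kernel P \<mu> x) (\<lambda>_. count_space UNIV)"
proof (rule Ionescu_Tulcea.intro)
  fix n
  show "bmp_kernel P \<mu> x n \<in>
      measurable (PiM {0..<n} (\<lambda>_. count_space UNIV)) (subprob_algebra (count_space UNIV))"
  proof (cases "n = 0")
    case True
    then show ?thesis
      unfolding bmp_kernel_def by (simp add: measure_pmf_in_subprob_algebra)
  next
    case False
    have "(\<lambda>B. B (n - 1)) \<in> measurable (PiM {0..<n} (\<lambda>_. count_space (UNIV :: 'a multiset set)))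
        (count_space UNIV)"
      using False by (intro measurable_component_singleton) auto
    moreover have "(\<lambda>M. measure_pmf (bmp_step P \<mu> M)) \<in>
        measurable (count_space UNIV) (subprob_algebra (count_space UNIV))"
      by (simp add: measure_pmf_in_subprob_algebra)
    ultimately have "(\<lambda>B. measure_pmf (bmp_step P \<mu> (B (n - 1)))) \<in>
        measurable (PiM {0..<n} (\<lambda>_. count_space UNIV)) (subprob_algebra (count_space UNIV))"
      by (rule measurable_compose)
    moreover have "bmp_kernel P \<mu> x n = (\<lambda>B. measure_pmf (bmp_step P \<mu> (B (n - 1))))"
      using False by (simp add: bmp_kernel_def fun_eq_iff)
    ultimately show ?thesis
      by (simp only:)
  qed
next
  show "prob_space (bmp_kernel P \<mu> x n B)" for n B
    unfolding bmp_kernel_def by (rule measure_pmf.prob_space_axioms)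
qed

lemma sets_bmp_law: "sets (bmp_law P \<mu> x) = sets (PiM UNIV (\<lambda>_. count_space UNIV))"
proof -
  interpret Ionescu_Tulcea "bmp_kernel P \<mu> x" "\<lambda>_. count_space UNIV"
    by (rule Ionescu_Tulcea_bmp)
  show ?thesis
    by (simp add: bmp_law_def)
qed

lemma emeasure_bmp_law_cylinder:
  "emeasure (bmp_law P \<mu> x) {B. \<forall>k\<le>n. B k = c k} =
     ennreal (of_bool (c 0 = {#x#}) * (\<Prod>k<n. pmf (bmp_step P \<mu> (c k)) (c (Suc k))))"
proof -
  let ?N = "\<lambda>_::nat. count_space (UNIV :: 'a multiset set)"
  interpret Ionescu_Tulcea "bmp_kernel P \<mu> x" ?N
    by (rule Ionescu_Tulcea_bmp)
  let ?E = "\<lambda>n. PiE {0..<n} (\<lambda>k. {c k})"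
  have E [measurable]: "?E n \<in> sets (PiM {0..<n} ?N)" for n
    by (intro sets_PiM_I_finite) auto
  have step: "emeasure (C 0 (Suc n) (\<lambda>_. undefined)) (?E (Suc n)) =
      emeasure (C 0 n (\<lambda>_. undefined)) (?E n) *
      ennreal (pmf (if n = 0 then return_pmf {#x#} else bmp_step P \<mu> (c (n - 1))) (c n))" for n
  proof -
    let ?p = "\<lambda>c. if n = 0 then return_pmf {#x#} else bmp_step P \<mu> (c (n - 1))"
    have "emeasure (C 0 (Suc n) (\<lambda>_. undefined)) (?E (Suc n)) =
        (\<integral>\<^sup>+B. emeasure (eP n B) (?E (Suc n)) \<partial>C 0 n (\<lambda>_. undefined))"
      by (subst C.simps, subst emeasure_bind[where N = "PiM {0..<Suc n} ?N"])
        (auto simp: space_C sets_C measurable_cong_sets[OF sets_C refl]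
          intro!: measurable_eP E)
    also have "\<dots> = (\<integral>\<^sup>+B. ennreal (pmf (?p c) (c n)) * indicator (?E n) B \<partial>C 0 n (\<lambda>_. undefined))"
    proof (rule nn_integral_cong)
      fix B assume "B \<in> space (C 0 n (\<lambda>_. undefined))"
      then have B: "B \<in> space (PiM {0..<n} ?N)"
        by (simp add: space_C)
      have eq: "(\<lambda>M. B(n := M)) -` ?E (Suc n) \<inter> space (count_space UNIV) =
          (if B \<in> ?E n then {c n} else {})"
        using B by (auto simp: PiE_iff space_PiM extensional_def less_Suc_eq split: if_splits)
      have "B (n - 1) = c (n - 1)" if "B \<in> ?E n" "n \<noteq> 0"
        using that by (auto simp: PiE_iff)
      then show "emeasure (eP n B) (?E (Suc n)) = ennreal (pmf (?p c) (c n)) * indicator (?E n) B"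
        unfolding emeasure_eP[OF B E] eq
        by (auto simp: bmp_kernel_def emeasure_pmf_single)
    qed
    also have "\<dots> = emeasure (C 0 n (\<lambda>_. undefined)) (?E n) * ennreal (pmf (?p c) (c n))"
      by (subst nn_integral_cmult_indicator) (auto simp: sets_C mult.commute intro!: E)
    finally show ?thesis .
  qed
  have CE: "emeasure (C 0 (Suc n) (\<lambda>_. undefined)) (?E (Suc n)) =
      ennreal (of_bool (c 0 = {#x#}) * (\<Prod>k<n. pmf (bmp_step P \<mu> (c k)) (c (Suc k))))" for n
  proof (induction n)
    case 0
    have "emeasure (C 0 0 (\<lambda>_. undefined)) (?E 0) = 1"
      by (simp add: emeasure_return[OF E[of 0], simplified])
    then show ?case
      unfolding step by (auto simp: pmf_return)
  next
    case (Suc n)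
    show ?case
      unfolding step[of "Suc n"] Suc.IH by (simp add: ennreal_mult prod_nonneg)
  qed
  have "{B. \<forall>k\<le>n. B k = c k} = prod_emb UNIV ?N {0..<Suc n} (?E (Suc n))"
    by (auto simp: prod_emb_def space_PiM PiE_iff less_Suc_eq_le)
  then have "emeasure (bmp_law P \<mu> x) {B. \<forall>k\<le>n. B k = c k} = emeasure (CI {0..<Suc n}) (?E (Suc n))"
    unfolding bmp_law_def by (simp only: lim[OF finite_atLeastLessThan E])
  also have "\<dots> = emeasure (C 0 (Suc n) (\<lambda>_. undefined)) (?E (Suc n))"
    by (subst emeasure_CI[OF order_refl E]) (subst prod_emb_id, auto simp: PiE_iff)
  finally show ?thesis
    by (simp only: CE)
qed

definition total_visits :: "'s set \<Rightarrow> (nat \<Rightarrow> 's multiset) \<Rightarrow> ennreal" where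
  "total_visits A B = (\<Sum>\<^sub>\<infinity>a\<in>A. \<Sum>n. of_nat (count (B n) a))"

definition visited_infinitely_often :: "'s set \<Rightarrow> (nat \<Rightarrow> 's multiset) \<Rightarrow> bool" where
  "visited_infinitely_often A B \<longleftrightarrow> total_visits A B = \<infinity>"

definition I_infty :: "'i set \<Rightarrow> ('i \<Rightarrow> 's set) \<Rightarrow> (nat \<Rightarrow> 's multiset) \<Rightarrow> 'i set" where
  "I_infty I A B = {i\<in>I. visited_infinitely_often (A i) B}"

definition survives :: "(nat \<Rightarrow> 's multiset) \<Rightarrow> bool" where
  "survives B \<longleftrightarrow> (\<forall>n. size (B n) > 0)"

end

theory Submission
  imports Defs
begin

text \<open>Only one kind of probability enters the proof: that of hitting a moving target
  \<open>D :: nat \<Rightarrow> 's set\<close>, i.e. of having a particle in \<open>D j\<close> at some time \<open>j\<close>. By the branching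
  property, the probability \<open>u\<close> of avoiding \<open>D\<close> satisfies \<open>u x = 0\<close> if \<open>x \<in> D 0\<close> and
  \<open>u x = f (P u' x)\<close> otherwise, where \<open>f\<close> is the generating function of the offspring law and \<open>u'\<close>
  is the avoidance probability of the shifted target.

  Let \<open>f\<close> and \<open>g\<close> belong to \<open>\<mu>\<close> and \<open>\<nu>\<close>, with \<open>g \<le> f\<close> on \<open>[1 - \<epsilon>, 1]\<close>, and let \<open>u\<close> and \<open>v\<close> be the
  avoidance probabilities. If \<open>v' \<le> 1 - \<epsilon> + \<epsilon> u'\<close> one step later, then
  \<open>v = g (P v') \<le> g (1 - \<epsilon> + \<epsilon> P u') \<le> f (1 - \<epsilon> + \<epsilon> P u') \<le> 1 - \<epsilon> + \<epsilon> f (P u') = 1 - \<epsilon> + \<epsilon> u\<close>: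
  shrinking hitting probabilities by the factor \<open>\<epsilon>\<close> moves all arguments into the range where the
  germ order can be used, and convexity of \<open>f\<close> lets the factor pass through. So every moving
  target is hit under \<open>\<nu>\<close> with at least \<open>\<epsilon>\<close> times its probability under \<open>\<mu>\<close>
  (\<open>prob_hit_gen_dominates\<close>).

  Enumerate the sets as \<open>A 0, A 1, \<dots>\<close>. The event \<open>E m\<close> that some \<open>A i\<close> with \<open>i \<ge> m\<close> is visited
  infinitely often is, up to probability \<open>\<delta>\<close> under \<open>\<nu>\<close>, the event of hitting a moving target: count
  visits to \<open>A i\<close> only from a late time \<open>N i\<close> on (\<open>choose_schedule\<close>). Under \<open>\<mu>\<close> it is always
  contained in that event. Hence the probability of \<open>E m\<close>, and on letting \<open>m\<close> grow that of
  infinitely many sets being visited infinitely often, is at least \<open>\<epsilon>\<close> times as large under \<open>\<nu>\<close>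
  as under \<open>\<mu>\<close> (\<open>prob_infinite_gen_dominates\<close>). This is the second claim.

  For the first claim, let \<open>s > 0\<close> be the survival probability under \<open>\<mu>\<close>, which does not depend
  on the starting point. By hypothesis, a process that survives under \<open>\<mu>\<close> satisfies \<open>E m\<close> almost
  surely. So from every starting point and for every time shift of the target above, the
  target is hit with probability at least \<open>s\<close> under \<open>\<mu>\<close>, hence at least \<open>\<epsilon> s\<close> under \<open>\<nu>\<close>. By the
  Markov property a surviving process under \<open>\<nu>\<close> therefore hits the target almost surely
  (\<open>AE_survives_hits\<close>), so that it fails \<open>E m\<close> with probability at most \<open>\<delta>\<close>, for every \<open>\<delta>\<close>.\<close>

section \<open>Generating functions and the branching property\<close>

text \<open>The generating function with values and arguments in \<^typ>\<open>ennreal\<close>, where the integrals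
  below need no integrability conditions.\<close>
definition gen :: "nat pmf \<Rightarrow> ennreal \<Rightarrow> ennreal" where
  "gen \<mu> t = (\<integral>\<^sup>+k. t ^ k \<partial>measure_pmf \<mu>)"

lemma nn_integral_replicate_pmf_prod_mset:
  "(\<integral>\<^sup>+xs. (\<Prod>y\<in>#mset xs. h y) \<partial>measure_pmf (replicate_pmf k p)) = (\<integral>\<^sup>+y. h y \<partial>measure_pmf p) ^ k"
proof (induction k)
  case (Suc k)
  have "(\<integral>\<^sup>+xs. (\<Prod>y\<in>#mset xs. h y) \<partial>measure_pmf (replicate_pmf (Suc k) p)) =
    (\<integral>\<^sup>+x. h x * (\<integral>\<^sup>+xs. (\<Prod>y\<in>#mset xs. h y) \<partial>measure_pmf (replicate_pmf k p)) \<partial>measure_pmf p)"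
    by (simp add: nn_integral_cmult)
  then show ?case
    by (simp add: Suc.IH nn_integral_multc)
qed simp

lemma nn_integral_brood:
  "(\<integral>\<^sup>+M. (\<Prod>y\<in>#M. h y) \<partial>measure_pmf (brood P \<mu> x)) = gen \<mu> (\<integral>\<^sup>+y. h y \<partial>measure_pmf (P x))"
  by (simp add: brood_def gen_def nn_integral_replicate_pmf_prod_mset)

lemma nn_integral_superpose:
  "(\<integral>\<^sup>+M. (\<Prod>y\<in>#M. h y) \<partial>measure_pmf (superpose p q)) =
    (\<integral>\<^sup>+M. (\<Prod>y\<in>#M. h y) \<partial>measure_pmf p) * (\<integral>\<^sup>+M. (\<Prod>y\<in>#M. h y) \<partial>measure_pmf q)"
  by (simp add: superpose_def nn_integral_pair_pmf' nn_integral_cmult nn_integral_multc)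

text \<open>The branching property for one generation: the children of distinct particles are independent,
  so multiplicative functionals stay multiplicative, with \<open>h\<close> transformed by the step
  of the chain followed by the generating function.\<close>
lemma nn_integral_bmp_step:
  "(\<integral>\<^sup>+M'. (\<Prod>y\<in>#M'. h y) \<partial>measure_pmf (bmp_step P \<mu> M)) =
    (\<Prod>x\<in>#M. gen \<mu> (\<integral>\<^sup>+y. h y \<partial>measure_pmf (P x)))"
  by (induction M) (simp_all add: nn_integral_superpose nn_integral_brood)

section \<open>Finite histories of the process\<close>

text \<open>Countability of the space of configurations makes finite histories discrete random variables,
  so that their law is determined by its point masses.\<close>
instance multiset :: (countable) countable
proof
  have "inj (\<lambda>M :: 'a multiset. to_nat (SOME xs. mset xs = M))"
  proof (rule injI)
    fix M N :: "'a multiset"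
    assume "to_nat (SOME xs. mset xs = M) = to_nat (SOME xs. mset xs = N)"
    moreover have "mset (SOME xs. mset xs = K) = K" for K :: "'a multiset"
      by (rule someI_ex) (rule ex_mset)
    ultimately show "M = N"
      by (metis injD inj_to_nat)
  qed
  then show "\<exists>to_nat :: 'a multiset \<Rightarrow> nat. inj to_nat"
    by blast
qed

definition history :: "nat \<Rightarrow> (nat \<Rightarrow> 's multiset) \<Rightarrow> 's multiset list" where
  "history n B = map B [0..<Suc n]"

lemma history_Suc: "history (Suc n) B = history n B @ [B (Suc n)]"
  by (simp add: history_def)

lemma last_history [simp]: "last (history n B) = B n"
  by (simp add: history_def)

lemma nth_history [simp]: "k \<le> n \<Longrightarrow> history n B ! k = B k"
  by (simp add: history_def del: upt_Suc)

fun history_pmf :: "('s \<Rightarrow> 's pmf) \<Rightarrow> nat pmf \<Rightarrow> 's \<Rightarrow> nat \<Rightarrow> 's multiset list pmf" where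
  "history_pmf P \<mu> x 0 = return_pmf [{#x#}]"
| "history_pmf P \<mu> x (Suc n) =
     bind_pmf (history_pmf P \<mu> x n) (\<lambda>l. map_pmf (\<lambda>M. l @ [M]) (bmp_step P \<mu> (last l)))"

text \<open>The right-hand side is the cylinder probability of \<open>bmp_law\<close>, so this identifies
  \<open>history_pmf\<close> as the law of the history.\<close>
lemma pmf_history_pmf:
  "pmf (history_pmf P \<mu> x n) (history n c) =
     of_bool (c 0 = {#x#}) * (\<Prod>k<n. pmf (bmp_step P \<mu> (c k)) (c (Suc k)))"
proof (induction n)
  case 0
  then show ?case
    by (auto simp: history_def pmf_return)
next
  case (Suc n)
  have "pmf (map_pmf (\<lambda>M. l @ [M]) (bmp_step P \<mu> (last l))) (history (Suc n) c) =
      pmf (bmp_step P \<mu> (c n)) (c (Suc n)) * indicator {history n c} l" for l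
  proof (cases "l = history n c")
    case True
    have "inj (\<lambda>M. l @ [M])"
      by (auto intro: injI)
    from pmf_map_inj'[OF this] show ?thesis
      by (simp add: True history_Suc)
  next
    case False
    then have "history (Suc n) c \<notin> set_pmf (map_pmf (\<lambda>M. l @ [M]) (bmp_step P \<mu> (last l)))"
      by (auto simp: history_Suc)
    then show ?thesis
      using False by (simp add: pmf_eq_0_set_pmf)
  qed
  then have "pmf (history_pmf P \<mu> x (Suc n)) (history (Suc n) c) =
      pmf (bmp_step P \<mu> (c n)) (c (Suc n)) * pmf (history_pmf P \<mu> x n) (history n c)"
    by (simp add: pmf_bind measure_pmf_single)
  then show ?case
    by (simp add: Suc.IH)
qed

lemma length_history_pmf: "l \<in> set_pmf (history_pmf P \<mu> x n) \<Longrightarrow> length l = Suc n"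
  by (induction n arbitrary: l) auto

lemma measurable_bmp_law_component [measurable]:
  "(\<lambda>B. B k) \<in> measurable (bmp_law P \<mu> x) (count_space UNIV)"
  unfolding measurable_cong_sets[OF sets_bmp_law refl] by simp

lemma measurable_history [measurable]:
  fixes P :: "'s :: countable \<Rightarrow> 's pmf"
  shows "history n \<in> measurable (bmp_law P \<mu> x) (count_space UNIV)"
proof (induction n)
  case 0
  have "(\<lambda>B. [B 0]) \<in> measurable (bmp_law P \<mu> x) (count_space UNIV)"
    by measurable
  then show ?case
    by (simp add: history_def)
next
  case (Suc n)
  note [measurable] = Suc
  show ?case
    unfolding history_Suc by measurable
qed

lemma space_bmp_law [simp]: "space (bmp_law P \<mu> x) = UNIV"
  using sets_eq_imp_space_eq[OF sets_bmp_law] by (simp add: space_PiM)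

lemma distr_history:
  fixes P :: "'s :: countable \<Rightarrow> 's pmf"
  shows "distr (bmp_law P \<mu> x) (count_space UNIV) (history n) = measure_pmf (history_pmf P \<mu> x n)"
proof (rule measure_eqI_countable[of _ UNIV])
  fix l :: "'s multiset list"
  show "emeasure (distr (bmp_law P \<mu> x) (count_space UNIV) (history n)) {l} =
      emeasure (measure_pmf (history_pmf P \<mu> x n)) {l}"
  proof (cases "length l = Suc n")
    case True
    define c where "c k = l ! k" for k
    have l: "l = history n c"
      using True by (intro nth_equalityI) (auto simp: history_def c_def simp del: upt_Suc)
    have "history n -` {l} = {B. \<forall>k\<le>n. B k = c k}"
      unfolding l by (auto simp: history_def less_Suc_eq_le simp del: upt_Suc)
    then show ?thesis
      using emeasure_bmp_law_cylinder[of P \<mu> x n c]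
      by (simp add: emeasure_distr emeasure_pmf_single l pmf_history_pmf)
  next
    case False
    then have "history n -` {l} = {}" and "l \<notin> set_pmf (history_pmf P \<mu> x n)"
      using length_history_pmf[of l P \<mu> x n] by (auto simp: history_def simp del: upt_Suc)
    then show ?thesis
      by (simp add: emeasure_distr emeasure_pmf_single pmf_eq_0_set_pmf)
  qed
qed auto

lemma sets_Collect_bmp_law: "Measurable.pred (bmp_law P \<mu> x) Q \<Longrightarrow> {B. Q B} \<in> sets (bmp_law P \<mu> x)"
  by (simp add: pred_def)

lemma nn_integral_of_bool_bmp_law:
  "Measurable.pred (bmp_law P \<mu> x) Q \<Longrightarrow> (\<integral>\<^sup>+B. of_bool (Q B) \<partial>bmp_law P \<mu> x) = emeasure (bmp_law P \<mu> x) {B. Q B}"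
  unfolding nn_integral_indicator[OF sets_Collect_bmp_law, symmetric] by (auto simp: indicator_def intro!: nn_integral_cong)

lemma prob_space_bmp_law:
  fixes P :: "'s :: countable \<Rightarrow> 's pmf"
  shows "prob_space (bmp_law P \<mu> x)"
proof (rule prob_spaceI)
  have "emeasure (bmp_law P \<mu> x) (space (bmp_law P \<mu> x)) =
      emeasure (distr (bmp_law P \<mu> x) (count_space UNIV) (history 0)) UNIV"
    by (subst emeasure_distr) auto
  then show "emeasure (bmp_law P \<mu> x) (space (bmp_law P \<mu> x)) = 1"
    unfolding distr_history by simp
qed

lemma nn_integral_history:
  fixes P :: "'s :: countable \<Rightarrow> 's pmf"
  shows "(\<integral>\<^sup>+B. \<phi> (history n B) \<partial>bmp_law P \<mu> x) = (\<integral>\<^sup>+l. \<phi> l \<partial>measure_pmf (history_pmf P \<mu> x n))"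
  unfolding distr_history[symmetric] by (subst nn_integral_distr) auto

text \<open>The Markov property at time \<open>n\<close>, for functionals of the next configuration.\<close>
lemma nn_integral_next_generation:
  fixes P :: "'s :: countable \<Rightarrow> 's pmf"
  shows "(\<integral>\<^sup>+B. \<phi> (history n B) * \<psi> (B (Suc n)) \<partial>bmp_law P \<mu> x) =
    (\<integral>\<^sup>+B. \<phi> (history n B) * (\<integral>\<^sup>+M. \<psi> M \<partial>measure_pmf (bmp_step P \<mu> (B n))) \<partial>bmp_law P \<mu> x)"
proof -
  have "(\<integral>\<^sup>+B. \<phi> (history n B) * \<psi> (B (Suc n)) \<partial>bmp_law P \<mu> x) =
      (\<integral>\<^sup>+B. \<phi> (butlast (history (Suc n) B)) * \<psi> (last (history (Suc n) B)) \<partial>bmp_law P \<mu> x)"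
    by (simp add: history_Suc)
  also have "\<dots> = (\<integral>\<^sup>+l. \<phi> l * (\<integral>\<^sup>+M. \<psi> M \<partial>measure_pmf (bmp_step P \<mu> (last l)))
      \<partial>measure_pmf (history_pmf P \<mu> x n))"
    unfolding nn_integral_history[where \<phi> = "\<lambda>l. \<phi> (butlast l) * \<psi> (last l)"]
    by (simp add: nn_integral_cmult)
  also have "\<dots> = (\<integral>\<^sup>+B. \<phi> (history n B) *
      (\<integral>\<^sup>+M. \<psi> M \<partial>measure_pmf (bmp_step P \<mu> (last (history n B)))) \<partial>bmp_law P \<mu> x)"
    by (rule nn_integral_history[symmetric])
  finally show ?thesis
    by simp
qed

lemma AE_bmp_law_start:
  fixes P :: "'s :: countable \<Rightarrow> 's pmf"
  shows "AE B in bmp_law P \<mu> x. B 0 = {#x#}"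
proof -
  have "AE l in distr (bmp_law P \<mu> x) (count_space UNIV) (history 0). last l = {#x#}"
    unfolding distr_history by (simp add: AE_measure_pmf_iff)
  then show ?thesis
    by (subst (asm) AE_distr_iff) auto
qed

lemma AE_bmp_law_extinct:
  fixes P :: "'s :: countable \<Rightarrow> 's pmf"
  shows "AE B in bmp_law P \<mu> x. B n = {#} \<longrightarrow> B (Suc n) = {#}"
proof -
  have "(\<integral>\<^sup>+B. of_bool (last (history n B) = {#}) * of_bool (B (Suc n) \<noteq> {#}) \<partial>bmp_law P \<mu> x) = 0"
    unfolding nn_integral_next_generation[where \<phi> = "\<lambda>l. of_bool (last l = {#})" and
        \<psi> = "\<lambda>M. of_bool (M \<noteq> {#})"]
    by (intro nn_integral_zero') (auto simp: of_bool_def)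
  then show ?thesis
    by (subst (asm) nn_integral_0_iff_AE) (auto elim!: eventually_mono)
qed

section \<open>Avoiding a moving target\<close>

text \<open>The probability that a process started at \<open>x\<close> has no particle in \<open>D j\<close> at time \<open>j\<close>, for all
  \<open>j \<le> m\<close>, written as the recursion that the branching property dictates. That it is this
  probability is shown in \<open>avoid_prob_eq_emeasure\<close>.\<close>
fun avoid_prob :: "('s \<Rightarrow> 's pmf) \<Rightarrow> nat pmf \<Rightarrow> (nat \<Rightarrow> 's set) \<Rightarrow> nat \<Rightarrow> 's \<Rightarrow> ennreal" where
  "avoid_prob P \<mu> D 0 x = of_bool (x \<notin> D 0)"
| "avoid_prob P \<mu> D (Suc m) x = of_bool (x \<notin> D 0) *
     gen \<mu> (\<integral>\<^sup>+y. avoid_prob P \<mu> (\<lambda>j. D (Suc j)) m y \<partial>measure_pmf (P x))"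

lemma prod_mset_of_bool:
  "(\<Prod>x\<in>#M. of_bool (x \<notin> X)) = (of_bool (set_mset M \<inter> X = {}) :: ennreal)"
  by (induction M) auto

text \<open>The Markov and branching properties at time \<open>n\<close> with a finite horizon: given the past, the
  particles alive at time \<open>n\<close> have to avoid the target independently of each other.\<close>
lemma nn_integral_avoid_from:
  fixes P :: "'s :: countable \<Rightarrow> 's pmf"
  shows "(\<integral>\<^sup>+B. \<phi> (history n B) * of_bool (\<forall>j\<le>m. set_mset (B (n + j)) \<inter> D j = {}) \<partial>bmp_law P \<mu> x) =
    (\<integral>\<^sup>+B. \<phi> (history n B) * (\<Prod>y\<in>#B n. avoid_prob P \<mu> D m y) \<partial>bmp_law P \<mu> x)"
proof (induction m arbitrary: n \<phi> D)
  case 0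
  then show ?case
    by (simp add: prod_mset_of_bool)
next
  case (Suc m)
  let ?a = "\<lambda>M. of_bool (set_mset M \<inter> D 0 = {}) :: ennreal"
  have split: "(\<forall>j\<le>Suc m. set_mset (B (n + j)) \<inter> D j = {}) \<longleftrightarrow>
      set_mset (B n) \<inter> D 0 = {} \<and> (\<forall>j\<le>m. set_mset (B (Suc n + j)) \<inter> D (Suc j) = {})" for B
    by (auto simp: All_less_Suc2 simp flip: less_Suc_eq_le)
  \<comment> \<open>The constraint at time \<open>n\<close> becomes part of the past, so that the induction hypothesis applies at time \<open>n + 1\<close>.\<close>
  have "(\<integral>\<^sup>+B. \<phi> (history n B) * of_bool (\<forall>j\<le>Suc m. set_mset (B (n + j)) \<inter> D j = {}) \<partial>bmp_law P \<mu> x) =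
    (\<integral>\<^sup>+B. (\<phi> (butlast (history (Suc n) B)) * ?a (last (butlast (history (Suc n) B)))) *
      of_bool (\<forall>j\<le>m. set_mset (B (Suc n + j)) \<inter> D (Suc j) = {}) \<partial>bmp_law P \<mu> x)"
    unfolding split of_bool_conj by (simp add: history_Suc mult.assoc)
  also have "\<dots> = (\<integral>\<^sup>+B. (\<phi> (history n B) * ?a (last (history n B))) *
      (\<Prod>y\<in>#B (Suc n). avoid_prob P \<mu> (\<lambda>j. D (Suc j)) m y) \<partial>bmp_law P \<mu> x)"
    unfolding Suc.IH[where n = "Suc n" and D = "\<lambda>j. D (Suc j)" and
        \<phi> = "\<lambda>l. \<phi> (butlast l) * ?a (last (butlast l))"]
    by (simp add: history_Suc)
  also have "\<dots> = (\<integral>\<^sup>+B. (\<phi> (history n B) * ?a (last (history n B))) *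
      (\<Prod>x\<in>#B n. gen \<mu> (\<integral>\<^sup>+y. avoid_prob P \<mu> (\<lambda>j. D (Suc j)) m y \<partial>measure_pmf (P x))) \<partial>bmp_law P \<mu> x)"
    unfolding nn_integral_next_generation[where \<phi> = "\<lambda>l. \<phi> l * ?a (last l)" and
        \<psi> = "\<lambda>M. \<Prod>y\<in>#M. avoid_prob P \<mu> (\<lambda>j. D (Suc j)) m y"] nn_integral_bmp_step ..
  also have "\<dots> = (\<integral>\<^sup>+B. \<phi> (history n B) * (\<Prod>y\<in>#B n. avoid_prob P \<mu> D (Suc m) y) \<partial>bmp_law P \<mu> x)"
    by (simp add: prod_mset.distrib prod_mset_of_bool mult.assoc)
  finally show ?case .
qed

lemma pred_bmp_law_component [measurable]:
  "Measurable.pred (bmp_law P \<mu> x) (\<lambda>B. Q (B k))"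
  by (rule measurable_compose[OF measurable_bmp_law_component]) simp

definition avoids :: "(nat \<Rightarrow> 's set) \<Rightarrow> (nat \<Rightarrow> 's multiset) \<Rightarrow> bool" where
  "avoids D B \<longleftrightarrow> (\<forall>j. set_mset (B j) \<inter> D j = {})"

lemma pred_avoids [measurable]:
  "Measurable.pred (bmp_law P \<mu> x) (\<lambda>B. avoids D (\<lambda>j. B (n + j)))"
  "Measurable.pred (bmp_law P \<mu> x) (avoids D)"
  unfolding avoids_def by measurable

lemma pred_avoid_until [measurable]:
  "Measurable.pred (bmp_law P \<mu> x) (\<lambda>B. \<forall>j\<le>m. set_mset (B (n + j)) \<inter> D j = {})"
  "Measurable.pred (bmp_law P \<mu> x) (\<lambda>B. \<forall>j\<le>m. set_mset (B j) \<inter> D j = {})"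
  by measurable

lemma avoid_prob_eq_emeasure:
  fixes P :: "'s :: countable \<Rightarrow> 's pmf"
  shows "avoid_prob P \<mu> D m x = emeasure (bmp_law P \<mu> x) {B. \<forall>j\<le>m. set_mset (B j) \<inter> D j = {}}"
proof -
  interpret prob_space "bmp_law P \<mu> x" by (rule prob_space_bmp_law)
  have "emeasure (bmp_law P \<mu> x) {B. \<forall>j\<le>m. set_mset (B j) \<inter> D j = {}} =
      (\<integral>\<^sup>+B. of_bool (\<forall>j\<le>m. set_mset (B (0 + j)) \<inter> D j = {}) \<partial>bmp_law P \<mu> x)"
    by (subst nn_integral_of_bool_bmp_law) auto
  also have "\<dots> = (\<integral>\<^sup>+B. (\<Prod>y\<in>#B 0. avoid_prob P \<mu> D m y) \<partial>bmp_law P \<mu> x)"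
    using nn_integral_avoid_from[where \<phi> = "\<lambda>_. 1" and n = 0] by simp
  also have "\<dots> = (\<integral>\<^sup>+B. avoid_prob P \<mu> D m x \<partial>bmp_law P \<mu> x)"
    by (rule nn_integral_cong_AE) (use AE_bmp_law_start in eventually_elim, simp)
  finally show ?thesis
    using emeasure_space_1 by simp
qed

lemma avoid_prob_le_1:
  fixes P :: "'s :: countable \<Rightarrow> 's pmf"
  shows "avoid_prob P \<mu> D m x \<le> 1"
  unfolding avoid_prob_eq_emeasure by (rule prob_space.emeasure_le_1[OF prob_space_bmp_law])

lemma avoid_prob_tendsto:
  fixes P :: "'s :: countable \<Rightarrow> 's pmf"
  shows "(\<lambda>m. avoid_prob P \<mu> D m x) \<longlonglongrightarrow> emeasure (bmp_law P \<mu> x) {B. avoids D B}"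
proof -
  interpret prob_space "bmp_law P \<mu> x" by (rule prob_space_bmp_law)
  let ?A = "\<lambda>m. {B. \<forall>j\<le>m. set_mset (B j) \<inter> D j = {}}"
  have "(\<lambda>m. emeasure (bmp_law P \<mu> x) (?A m)) \<longlonglongrightarrow> emeasure (bmp_law P \<mu> x) (\<Inter>m. ?A m)"
  proof (rule Lim_emeasure_decseq)
    show "range ?A \<subseteq> sets (bmp_law P \<mu> x)"
      by (rule image_subsetI, rule sets_Collect_bmp_law, rule pred_avoid_until(2))
    show "decseq ?A"
      by (rule decseq_SucI) (auto simp: le_Suc_eq)
  qed auto
  moreover have "(\<Inter>m. ?A m) = {B. avoids D B}"
    by (auto simp: avoids_def)
  ultimately show ?thesis
    by (simp add: avoid_prob_eq_emeasure)
qed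

lemma tendsto_prod_mset_ennreal:
  fixes f :: "nat \<Rightarrow> 'a \<Rightarrow> ennreal"
  assumes "\<And>x. (\<lambda>n. f n x) \<longlonglongrightarrow> g x" and "\<And>x. g x < top"
  shows "(\<lambda>n. \<Prod>x\<in>#M. f n x) \<longlonglongrightarrow> (\<Prod>x\<in>#M. g x) \<and> (\<Prod>x\<in>#M. g x) < top"
proof (induction M)
  case (add x M)
  then show ?case
    using assms(1)[of x] assms(2)[of x]
    by (auto intro!: tendsto_mult_ennreal simp: ennreal_mult_less_top)
qed simp

text \<open>The same properties with an infinite horizon, by dominated convergence.\<close>
lemma emeasure_avoid_from:
  fixes P :: "'s :: countable \<Rightarrow> 's pmf"
  shows "emeasure (bmp_law P \<mu> x) {B. F (history n B) \<and> avoids D (\<lambda>j. B (n + j))} =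
    (\<integral>\<^sup>+B. of_bool (F (history n B)) *
      (\<Prod>y\<in>#B n. emeasure (bmp_law P \<mu> y) {B. avoids D B}) \<partial>bmp_law P \<mu> x)"
proof -
  interpret prob_space "bmp_law P \<mu> x" by (rule prob_space_bmp_law)
  have F [measurable]: "Measurable.pred (bmp_law P \<mu> x) (\<lambda>B. F (history n B))"
    by (rule measurable_compose[OF measurable_history]) simp
  let ?f = "\<lambda>m. (\<integral>\<^sup>+B. of_bool (F (history n B)) * (\<Prod>y\<in>#B n. avoid_prob P \<mu> D m y) \<partial>bmp_law P \<mu> x)"
  have meas [measurable]: "(\<lambda>B. of_bool (F (history n B)) * (\<Prod>y\<in>#B n. h y)) \<in> borel_measurable (bmp_law P \<mu> x)"
    for h :: "'s \<Rightarrow> ennreal"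
    using measurable_compose[OF measurable_history[of n P \<mu> x],
        of "\<lambda>l. of_bool (F l) * (\<Prod>y\<in>#last l. h y)"] by simp
  have lim1: "?f \<longlonglongrightarrow> (\<integral>\<^sup>+B. of_bool (F (history n B)) *
      (\<Prod>y\<in>#B n. emeasure (bmp_law P \<mu> y) {B. avoids D B}) \<partial>bmp_law P \<mu> x)"
  proof (rule nn_integral_dominated_convergence[where w = "\<lambda>_. 1"])
    show "AE B in bmp_law P \<mu> x. of_bool (F (history n B)) * (\<Prod>y\<in>#B n. avoid_prob P \<mu> D m y) \<le> 1" for m
    proof (rule AE_I2)
      fix B
      have "(\<Prod>y\<in>#M. avoid_prob P \<mu> D m y) \<le> 1" for M
        by (induction M) (auto intro!: mult_le_one avoid_prob_le_1)
      then show "of_bool (F (history n B)) * (\<Prod>y\<in>#B n. avoid_prob P \<mu> D m y) \<le> 1"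
        by (auto simp: of_bool_def)
    qed
    have "emeasure (bmp_law P \<mu> y) {B. avoids D B} < top" for y
      using prob_space.emeasure_le_1[OF prob_space_bmp_law, of P \<mu> y "{B. avoids D B}"]
        le_less_trans ennreal_one_less_top by blast
    then show "AE B in bmp_law P \<mu> x. (\<lambda>m. of_bool (F (history n B)) * (\<Prod>y\<in>#B n. avoid_prob P \<mu> D m y)) \<longlonglongrightarrow>
        of_bool (F (history n B)) * (\<Prod>y\<in>#B n. emeasure (bmp_law P \<mu> y) {B. avoids D B})"
      using tendsto_prod_mset_ennreal[of "avoid_prob P \<mu> D", OF avoid_prob_tendsto]
      by (auto simp: of_bool_def)
  qed (use emeasure_space_1 in auto)
  let ?A = "\<lambda>m. {B. F (history n B) \<and> (\<forall>j\<le>m. set_mset (B (n + j)) \<inter> D j = {})}"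
  have A: "?A m \<in> sets (bmp_law P \<mu> x)" for m
    by (rule sets_Collect_bmp_law[OF pred_intros_logic(3)[OF F pred_avoid_until(1)]])
  have "?f m = emeasure (bmp_law P \<mu> x) (?A m)" for m
    unfolding nn_integral_avoid_from[where \<phi> = "\<lambda>l. of_bool (F l)", symmetric]
    by (subst nn_integral_of_bool_bmp_law[symmetric]) (auto simp: of_bool_conj)
  moreover have "(\<lambda>m. emeasure (bmp_law P \<mu> x) (?A m)) \<longlonglongrightarrow> emeasure (bmp_law P \<mu> x) (\<Inter>m. ?A m)"
  proof (rule Lim_emeasure_decseq)
    show "decseq ?A"
      by (rule decseq_SucI) (auto simp: le_Suc_eq)
  qed (use A in auto)
  moreover have "(\<Inter>m. ?A m) = {B. F (history n B) \<and> avoids D (\<lambda>j. B (n + j))}"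
    by (auto simp: avoids_def)
  ultimately show ?thesis
    using LIMSEQ_unique[OF lim1] by simp
qed

section \<open>Comparison of hitting probabilities\<close>

lemma convex_power_ennreal:
  fixes s :: ennreal
  assumes ab: "a + b = 1" and s: "s \<le> 1"
  shows "(a + b * s) ^ k \<le> a + b * s ^ k"
proof -
  have real: "(u + v * t) ^ k \<le> u + v * t ^ k"
    if "0 \<le> u" "0 \<le> v" "u + v = 1" "0 \<le> t" "t \<le> 1" for u v t :: real
  proof (induction k)
    case (Suc k)
    have v: "v = 1 - u" using that by simp
    have "(u + v * t) ^ Suc k \<le> (u + v * t) * (u + v * t ^ k)"
      using that Suc.IH by (simp add: mult_left_mono)
    also have "\<dots> = u + v * t ^ Suc k - u * v * ((1 - t) * (1 - t ^ k))"
      unfolding v by (simp add: algebra_simps)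
    also have "\<dots> \<le> u + v * t ^ Suc k"
      using that by (simp add: power_le_one)
    finally show ?case .
  qed (use that in simp)
  have "a \<le> 1" "b \<le> 1"
    using ab by (metis le_iff_add, metis le_iff_add add.commute)
  then obtain u v t where r: "a = ennreal u" "b = ennreal v" "s = ennreal t" "0 \<le> u" "0 \<le> v" "0 \<le> t"
    using s by (metis ennreal_cases ennreal_one_less_top leD order_le_less_trans top.not_eq_extremum)
  then have "u + v = 1" "t \<le> 1"
    using ab s by (auto simp flip: ennreal_plus)
  with real[of u v t] r show ?thesis
    by (simp add: ennreal_power flip: ennreal_mult' ennreal_plus)
qed

lemma gen_convex:
  assumes "a + b = 1" and "s \<le> 1"
  shows "gen \<mu> (a + b * s) \<le> a + b * gen \<mu> s"
proof -
  have "gen \<mu> (a + b * s) \<le> (\<integral>\<^sup>+k. a + b * s ^ k \<partial>measure_pmf \<mu>)"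
    unfolding gen_def by (intro nn_integral_mono convex_power_ennreal assms)
  then show ?thesis
    by (simp add: gen_def nn_integral_add nn_integral_cmult measure_pmf.emeasure_space_1)
qed

lemma gen_mono: "s \<le> t \<Longrightarrow> gen \<mu> s \<le> gen \<mu> t"
  unfolding gen_def by (intro nn_integral_mono power_mono) auto

text \<open>The germ order with an explicit \<open>\<epsilon>\<close>. The bound \<open>\<epsilon> \<le> 1\<close> makes \<open>1 - \<epsilon>\<close> and \<open>\<epsilon>\<close> the weights of
  a convex combination.\<close>
definition gen_dominates :: "real \<Rightarrow> nat pmf \<Rightarrow> nat pmf \<Rightarrow> bool" where
  "gen_dominates \<epsilon> \<mu> \<nu> \<longleftrightarrow> 0 < \<epsilon> \<and> \<epsilon> \<le> 1 \<and> (\<forall>t. ennreal (1 - \<epsilon>) \<le> t \<longrightarrow> t \<le> 1 \<longrightarrow> gen \<nu> t \<le> gen \<mu> t)"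

lemma gen_eq_pgf:
  assumes "0 \<le> t" "t \<le> 1"
  shows "gen \<mu> (ennreal t) = ennreal (pgf (offspring_measure \<mu>) t)"
proof -
  have "integrable (measure_pmf \<mu>) (\<lambda>k. t ^ k)"
    using assms by (intro measure_pmf.integrable_const_bound[where B = 1]) (auto simp: power_le_one)
  then show ?thesis
    using assms unfolding pgf_offspring_measure[OF assms(1)] gen_def
    by (subst nn_integral_eq_integral[symmetric]) (auto simp: ennreal_power intro!: nn_integral_cong)
qed

lemma germ_le_imp_gen_dominates:
  assumes "offspring_measure \<mu> \<le>\<^sub>g\<^sub>e\<^sub>r\<^sub>m offspring_measure \<nu>"
  obtains \<epsilon> where "gen_dominates \<epsilon> \<mu> \<nu>"
proof -
  obtain \<epsilon> where \<epsilon>: "\<epsilon> > 0" "\<And>t. 0 \<le> t \<Longrightarrow> t \<le> 1 \<Longrightarrow> 1 - \<epsilon> \<le> t \<Longrightarrow>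
      pgf (offspring_measure \<nu>) t \<le> pgf (offspring_measure \<mu>) t"
    using assms unfolding germ_le_def by auto
  have "gen_dominates (min \<epsilon> 1) \<mu> \<nu>"
    unfolding gen_dominates_def
  proof (intro conjI allI impI)
    fix t :: ennreal
    assume t: "ennreal (1 - min \<epsilon> 1) \<le> t" "t \<le> 1"
    then obtain r where r: "t = ennreal r" "0 \<le> r"
      by (metis ennreal_cases ennreal_one_less_top leD)
    have "r \<le> 1" "1 - min \<epsilon> 1 \<le> r"
      using t r by (auto simp: r(1))
    then show "gen \<nu> t \<le> gen \<mu> t"
      using \<epsilon> r by (auto simp: gen_eq_pgf intro!: ennreal_leI)
  qed (use \<epsilon> in auto)
  then show ?thesis by (rule that)
qed

text \<open>Both the germ order and convexity are used at the point \<open>1 - \<epsilon> + \<epsilon> s\<close>, which is at least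
  \<open>1 - \<epsilon>\<close> no matter how small the avoidance probability \<open>s\<close> is. This is why the comparison of the
  generating functions near 1 suffices.\<close>
lemma avoid_prob_gen_dominates:
  fixes P :: "'s :: countable \<Rightarrow> 's pmf"
  assumes dom: "gen_dominates \<epsilon> \<mu> \<nu>"
  shows "avoid_prob P \<nu> D m x \<le> ennreal (1 - \<epsilon>) + ennreal \<epsilon> * avoid_prob P \<mu> D m x"
proof (induction m arbitrary: D x)
  case 0
  then show ?case
    using dom by (auto simp: of_bool_def gen_dominates_def simp flip: ennreal_plus)
next
  case (Suc m)
  have ab: "ennreal (1 - \<epsilon>) + ennreal \<epsilon> = 1"
    using dom by (simp add: gen_dominates_def flip: ennreal_plus)
  let ?D = "\<lambda>j. D (Suc j)"
  let ?s = "\<integral>\<^sup>+y. avoid_prob P \<mu> ?D m y \<partial>measure_pmf (P x)"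
  have s: "?s \<le> 1"
    using nn_integral_mono[of "measure_pmf (P x)" "avoid_prob P \<mu> ?D m" "\<lambda>_. 1"]
    by (simp add: avoid_prob_le_1 measure_pmf.emeasure_space_1)
  have "(\<integral>\<^sup>+y. avoid_prob P \<nu> ?D m y \<partial>measure_pmf (P x)) \<le>
      (\<integral>\<^sup>+y. ennreal (1 - \<epsilon>) + ennreal \<epsilon> * avoid_prob P \<mu> ?D m y \<partial>measure_pmf (P x))"
    by (intro nn_integral_mono Suc.IH)
  also have "\<dots> = ennreal (1 - \<epsilon>) + ennreal \<epsilon> * ?s"
    by (simp add: nn_integral_add nn_integral_cmult measure_pmf.emeasure_space_1)
  finally have "gen \<nu> (\<integral>\<^sup>+y. avoid_prob P \<nu> ?D m y \<partial>measure_pmf (P x)) \<le>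
      gen \<nu> (ennreal (1 - \<epsilon>) + ennreal \<epsilon> * ?s)"
    by (rule gen_mono)
  also have "\<dots> \<le> gen \<mu> (ennreal (1 - \<epsilon>) + ennreal \<epsilon> * ?s)"
  proof -
    have "ennreal (1 - \<epsilon>) + ennreal \<epsilon> * ?s \<le> ennreal (1 - \<epsilon>) + ennreal \<epsilon> * 1"
      by (intro add_left_mono mult_left_mono s) auto
    then show ?thesis
      using dom ab by (simp add: gen_dominates_def)
  qed
  also have "\<dots> \<le> ennreal (1 - \<epsilon>) + ennreal \<epsilon> * gen \<mu> ?s"
    by (rule gen_convex[OF ab s])
  finally show ?case
    by (simp add: of_bool_def)
qed

lemma prob_hit_gen_dominates:
  fixes P :: "'s :: countable \<Rightarrow> 's pmf"
  assumes dom: "gen_dominates \<epsilon> \<mu> \<nu>"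
  shows "\<epsilon> * \<P>(B in bmp_law P \<mu> x. \<not> avoids D B) \<le> \<P>(B in bmp_law P \<nu> x. \<not> avoids D B)"
proof -
  interpret M: prob_space "bmp_law P \<mu> x" by (rule prob_space_bmp_law)
  interpret N: prob_space "bmp_law P \<nu> x" by (rule prob_space_bmp_law)
  have \<epsilon>: "0 < \<epsilon>" "\<epsilon> \<le> 1"
    using dom by (auto simp: gen_dominates_def)
  have "emeasure (bmp_law P \<nu> x) {B. avoids D B} \<le>
      ennreal (1 - \<epsilon>) + ennreal \<epsilon> * emeasure (bmp_law P \<mu> x) {B. avoids D B}"
  proof (rule LIMSEQ_le[OF avoid_prob_tendsto])
    show "(\<lambda>m. ennreal (1 - \<epsilon>) + ennreal \<epsilon> * avoid_prob P \<mu> D m x) \<longlonglongrightarrow>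
        ennreal (1 - \<epsilon>) + ennreal \<epsilon> * emeasure (bmp_law P \<mu> x) {B. avoids D B}"
      by (intro tendsto_intros avoid_prob_tendsto ennreal_tendsto_cmult) auto
  qed (intro exI[of _ 0] allI impI avoid_prob_gen_dominates[OF dom])
  then have "measure (bmp_law P \<nu> x) {B. avoids D B} \<le> 1 - \<epsilon> + \<epsilon> * measure (bmp_law P \<mu> x) {B. avoids D B}"
    using \<epsilon> by (simp add: M.emeasure_eq_measure N.emeasure_eq_measure
        flip: ennreal_mult ennreal_plus)
  moreover have "M.prob {B. \<not> avoids D B} = 1 - M.prob {B. avoids D B}"
    using M.prob_neg[of "avoids D"] by (simp add: sets_Collect_bmp_law)
  moreover have "N.prob {B. \<not> avoids D B} = 1 - N.prob {B. avoids D B}"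
    using N.prob_neg[of "avoids D"] by (simp add: sets_Collect_bmp_law)
  ultimately have "\<epsilon> * M.prob {B. \<not> avoids D B} \<le> N.prob {B. \<not> avoids D B}"
    by (simp only:) (simp add: right_diff_distrib)
  then show ?thesis
    by simp
qed

section \<open>Sets visited infinitely often\<close>

text \<open>Each configuration is finite, so infinitely many visits must be spread over infinitely many
  times.\<close>
lemma visited_infinitely_often_iff:
  "visited_infinitely_often A B \<longleftrightarrow> (\<exists>\<^sub>\<infinity>n. set_mset (B n) \<inter> A \<noteq> {})"
proof
  assume io: "visited_infinitely_often A B"
  show "\<exists>\<^sub>\<infinity>n. set_mset (B n) \<inter> A \<noteq> {}"
  proof (rule ccontr)
    define T where "T = {n. set_mset (B n) \<inter> A \<noteq> {}}"
    assume "\<not> (\<exists>\<^sub>\<infinity>n. set_mset (B n) \<inter> A \<noteq> {})"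
    then have T: "finite T"
      by (simp add: frequently_cofinite T_def)
    define S where "S = (\<Union>n\<in>T. set_mset (B n) \<inter> A)"
    have S: "finite S"
      using T by (auto simp: S_def)
    have count_0: "count (B n) a = 0" if "a \<in> A" "n \<notin> T \<or> a \<notin> S" for a n
      using that by (auto simp: S_def T_def not_in_iff[symmetric])
    have "total_visits A B = (\<Sum>\<^sub>\<infinity>a\<in>S. \<Sum>n. of_nat (count (B n) a))"
      unfolding total_visits_def by (rule infsum_cong_neutral) (auto simp: count_0 S_def)
    also have "\<dots> = (\<Sum>a\<in>S. \<Sum>n\<in>T. of_nat (count (B n) a))"
      unfolding infsum_finite[OF S]
      by (intro sum.cong suminf_finite T refl) (auto simp: S_def count_0)
    finally show False
      using io by (simp add: visited_infinitely_often_def flip: of_nat_sum)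
  qed
next
  assume inf: "\<exists>\<^sub>\<infinity>n. set_mset (B n) \<inter> A \<noteq> {}"
  have "of_nat k \<le> total_visits A B" for k
  proof -
    obtain F where F: "finite F" "card F = k" "F \<subseteq> {n. set_mset (B n) \<inter> A \<noteq> {}}"
      using inf infinite_arbitrarily_large[of "{n. set_mset (B n) \<inter> A \<noteq> {}}" k]
      by (auto simp: frequently_cofinite)
    define S where "S = (\<Union>n\<in>F. set_mset (B n) \<inter> A)"
    have S: "finite S" "S \<subseteq> A"
      using F by (auto simp: S_def)
    have "1 \<le> (\<Sum>a\<in>S. count (B n) a)" if "n \<in> F" for n
    proof -
      have "set_mset (B n) \<inter> A \<noteq> {}"
        using subsetD[OF F(3) that] by simp
      then obtain a where "a \<in># B n" "a \<in> A"
        by blast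
      then have "1 \<le> count (B n) a" "a \<in> S"
        using that by (auto simp: S_def)
      then show ?thesis
        using member_le_sum[of a S "count (B n)"] S(1) by (meson order_trans zero_le)
    qed
    then have "k \<le> (\<Sum>n\<in>F. \<Sum>a\<in>S. count (B n) a)"
      using sum_mono[of F "\<lambda>_. 1" "\<lambda>n. \<Sum>a\<in>S. count (B n) a"] F(2) by simp
    then have "of_nat k \<le> (\<Sum>a\<in>S. \<Sum>n\<in>F. of_nat (count (B n) a) :: ennreal)"
      unfolding sum.swap[of _ S F] of_nat_sum[symmetric] by (rule of_nat_mono)
    also have "\<dots> \<le> (\<Sum>a\<in>S. \<Sum>n. of_nat (count (B n) a))"
      using F(1) by (intro sum_mono sum_le_suminf) auto
    also have "\<dots> = (\<Sum>\<^sub>\<infinity>a\<in>S. \<Sum>n. of_nat (count (B n) a))"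
      using S(1) by simp
    also have "\<dots> \<le> total_visits A B"
      unfolding total_visits_def using S(2) by (intro infsum_mono_neutral nonneg_summable_on_complete) auto
    finally show ?thesis .
  qed
  then show "visited_infinitely_often A B"
    unfolding visited_infinitely_often_def infinity_ennreal_def
    by (metis ennreal_Ex_less_of_nat leD top.not_eq_extremum)
qed

text \<open>For sets indexed by natural numbers, infinitely many of them are visited infinitely often
  precisely if this holds for all \<open>m\<close>. In contrast to that event, it is a union over the sets and
  hence, approximately, the event of hitting a target.\<close>
definition io_beyond :: "(nat \<Rightarrow> 's set) \<Rightarrow> nat \<Rightarrow> (nat \<Rightarrow> 's multiset) \<Rightarrow> bool" where
  "io_beyond A m B \<longleftrightarrow> (\<exists>i\<ge>m. \<exists>\<^sub>\<infinity>n. set_mset (B n) \<inter> A i \<noteq> {})"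

lemma pred_io [measurable]:
  "Measurable.pred (bmp_law P \<mu> x) (\<lambda>B. \<exists>\<^sub>\<infinity>n. set_mset (B n) \<inter> X \<noteq> {})"
  unfolding INFM_nat by measurable

lemma pred_io_beyond [measurable]: "Measurable.pred (bmp_law P \<mu> x) (io_beyond A m)"
  unfolding io_beyond_def by measurable

lemma infinite_I_infty_iff:
  fixes A :: "'i \<Rightarrow> 's set"
  assumes "countable I"
  obtains A' :: "nat \<Rightarrow> 's set" where "\<And>B. infinite (I_infty I A B) \<longleftrightarrow> (\<forall>m. io_beyond A' m B)"
proof -
  define e where "e = to_nat_on I"
  have e: "inj_on e I"
    unfolding e_def by (rule inj_on_to_nat_on[OF assms])
  \<comment> \<open>Natural numbers that are no index get the empty set, which is never visited.\<close>
  define A' where "A' k = (if k \<in> e ` I then A (inv_into I e k) else {})" for k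
  have "infinite (I_infty I A B) \<longleftrightarrow> (\<forall>m. io_beyond A' m B)" for B
  proof -
    have "A' (e i) = A i" if "i \<in> I" for i
      using that e by (simp add: A'_def)
    moreover have "k \<in> e ` I" if "\<exists>\<^sub>\<infinity>n. set_mset (B n) \<inter> A' k \<noteq> {}" for k
      using that by (auto simp: A'_def frequently_const split: if_splits)
    ultimately have "{k. \<exists>\<^sub>\<infinity>n. set_mset (B n) \<inter> A' k \<noteq> {}} = e ` I_infty I A B"
      by (force simp: I_infty_def visited_infinitely_often_iff)
    moreover have "finite (e ` I_infty I A B) \<longleftrightarrow> finite (I_infty I A B)"
      by (rule finite_image_iff, rule inj_on_subset[OF e]) (auto simp: I_infty_def)
    ultimately have "finite (I_infty I A B) \<longleftrightarrow> finite {k. \<exists>\<^sub>\<infinity>n. set_mset (B n) \<inter> A' k \<noteq> {}}"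
      by simp
    then show ?thesis
      by (auto simp: io_beyond_def infinite_nat_iff_unbounded_le)
  qed
  then show ?thesis by (rule that)
qed

text \<open>The moving target that contains \<open>A i\<close> from time \<open>N i\<close> on, for \<open>i \<ge> m\<close>.\<close>
definition scheduled :: "(nat \<Rightarrow> 's set) \<Rightarrow> nat \<Rightarrow> (nat \<Rightarrow> nat) \<Rightarrow> nat \<Rightarrow> 's set" where
  "scheduled A m N j = (\<Union>i\<in>{i. m \<le> i \<and> N i \<le> j}. A i)"

text \<open>A set visited infinitely often is visited after any prescribed time, so the target is hit
  under every schedule and after every time shift.\<close>
lemma io_beyond_hits_scheduled:
  assumes "io_beyond A m B"
  shows "\<not> avoids (\<lambda>j. scheduled A m N (k + j)) B"
proof -
  obtain i where i: "i \<ge> m" "\<exists>\<^sub>\<infinity>n. set_mset (B n) \<inter> A i \<noteq> {}"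
    using assms by (auto simp: io_beyond_def)
  then obtain n where "n \<ge> N i" "set_mset (B n) \<inter> A i \<noteq> {}"
    by (meson INFM_nat_le)
  with i show ?thesis
    by (fastforce simp: avoids_def scheduled_def)
qed

text \<open>A set that is visited finitely often is not visited after some random time. A deterministic
  time \<open>N i\<close> that exceeds it up to probability \<open>\<delta> / 2\<^sup>i\<^sup>+\<^sup>1\<close> gives a summable error.\<close>
lemma (in prob_space) choose_schedule:
  fixes A :: "nat \<Rightarrow> 's set"
  assumes meas [measurable]: "\<And>n i. Measurable.pred M (\<lambda>\<omega>. set_mset (X \<omega> n) \<inter> A i \<noteq> {})" and "\<delta> > 0"
  obtains N where "\<P>(\<omega> in M. \<not> avoids (scheduled A m N) (X \<omega>) \<and> \<not> io_beyond A m (X \<omega>)) \<le> \<delta>"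
proof -
  define bad where "bad i N = {\<omega>\<in>space M. (\<exists>n\<ge>N. set_mset (X \<omega> n) \<inter> A i \<noteq> {}) \<and>
      \<not> (\<exists>\<^sub>\<infinity>n. set_mset (X \<omega> n) \<inter> A i \<noteq> {})}" for i N
  have io [measurable]: "Measurable.pred M (\<lambda>\<omega>. \<exists>\<^sub>\<infinity>n. set_mset (X \<omega> n) \<inter> A i \<noteq> {})" for i
    unfolding INFM_nat by measurable
  have bad_sets [measurable]: "bad i N \<in> events" for i N
    unfolding bad_def by measurable
  have "\<exists>N. prob (bad i N) < \<delta> * (1/2) ^ Suc i" for i
  proof -
    have "(\<lambda>N. prob (bad i N)) \<longlonglongrightarrow> prob (\<Inter>N. bad i N)"
    proof (rule finite_Lim_measure_decseq)
      show "decseq (bad i)"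
        unfolding bad_def by (rule decseq_SucI) (auto dest: Suc_leD)
    qed auto
    moreover have "(\<Inter>N. bad i N) = {}"
      unfolding bad_def INFM_nat_le by blast
    ultimately have "(\<lambda>N. prob (bad i N)) \<longlonglongrightarrow> 0"
      by simp
    then have "eventually (\<lambda>N. prob (bad i N) < \<delta> * (1/2) ^ Suc i) sequentially"
      using \<open>\<delta> > 0\<close> by (intro order_tendstoD) auto
    then show ?thesis
      by (auto simp: eventually_sequentially)
  qed
  then obtain N where N: "\<And>i. prob (bad i (N i)) < \<delta> * (1/2) ^ Suc i"
    by metis
  have sums: "(\<lambda>i. \<delta> * (1/2) ^ Suc i) sums \<delta>"
    using sums_mult[OF power_half_series, of \<delta>] by simp
  have summ: "summable (\<lambda>i. prob (bad i (N i)))"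
    by (rule summable_comparison_test'[OF sums_summable[OF sums], of 0])
      (use N in \<open>auto intro: less_imp_le\<close>)
  have "{\<omega>\<in>space M. \<not> avoids (scheduled A m N) (X \<omega>) \<and> \<not> io_beyond A m (X \<omega>)} \<subseteq> (\<Union>i. bad i (N i))"
  proof (rule subsetI)
    fix \<omega>
    assume *: "\<omega> \<in> {\<omega>\<in>space M. \<not> avoids (scheduled A m N) (X \<omega>) \<and> \<not> io_beyond A m (X \<omega>)}"
    then obtain n i where "m \<le> i" "N i \<le> n" "set_mset (X \<omega> n) \<inter> A i \<noteq> {}"
      by (auto simp: avoids_def scheduled_def)
    moreover from this * have "\<not> (\<exists>\<^sub>\<infinity>n. set_mset (X \<omega> n) \<inter> A i \<noteq> {})"
      by (auto simp: io_beyond_def)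
    ultimately have "\<omega> \<in> bad i (N i)"
      using * by (auto simp: bad_def)
    then show "\<omega> \<in> (\<Union>i. bad i (N i))"
      by blast
  qed
  then have "prob {\<omega>\<in>space M. \<not> avoids (scheduled A m N) (X \<omega>) \<and> \<not> io_beyond A m (X \<omega>)} \<le>
      prob (\<Union>i. bad i (N i))"
    by (intro finite_measure_mono) auto
  also have "\<dots> \<le> (\<Sum>i. prob (bad i (N i)))"
    by (intro finite_measure_subadditive_countably summ) auto
  also have "\<dots> \<le> (\<Sum>i. \<delta> * (1/2) ^ Suc i)"
    by (rule suminf_le[OF less_imp_le[OF N] summ sums_summable[OF sums]])
  also have "\<dots> = \<delta>"
    by (rule sums_unique[OF sums, symmetric])
  finally show ?thesis
    by (rule that)
qed

text \<open>The schedule is chosen for \<open>\<nu>\<close>, where the target must not be hit much more often than sets are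
  visited infinitely often. Under \<open>\<mu>\<close> only the inclusion that holds for every schedule is needed.\<close>
lemma prob_io_beyond_gen_dominates:
  fixes P :: "'s :: countable \<Rightarrow> 's pmf"
  assumes dom: "gen_dominates \<epsilon> \<mu> \<nu>"
  shows "\<epsilon> * \<P>(B in bmp_law P \<mu> x. io_beyond A m B) \<le> \<P>(B in bmp_law P \<nu> x. io_beyond A m B)"
proof (rule field_le_epsilon)
  fix \<delta> :: real assume "\<delta> > 0"
  interpret M: prob_space "bmp_law P \<mu> x" by (rule prob_space_bmp_law)
  interpret N: prob_space "bmp_law P \<nu> x" by (rule prob_space_bmp_law)
  obtain N where N: "\<P>(B in bmp_law P \<nu> x. \<not> avoids (scheduled A m N) B \<and> \<not> io_beyond A m B) \<le> \<delta>"
    using N.choose_schedule[where X = "\<lambda>B. B" and A = A and m = m, OF _ \<open>\<delta> > 0\<close>] by auto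
  have \<epsilon>: "0 < \<epsilon>"
    using dom by (auto simp: gen_dominates_def)
  have "\<P>(B in bmp_law P \<mu> x. io_beyond A m B) \<le> \<P>(B in bmp_law P \<mu> x. \<not> avoids (scheduled A m N) B)"
    using io_beyond_hits_scheduled[of A m _ N 0] by (intro M.finite_measure_mono) (auto intro!: sets_Collect_bmp_law)
  then have "\<epsilon> * \<P>(B in bmp_law P \<mu> x. io_beyond A m B) \<le>
      \<epsilon> * \<P>(B in bmp_law P \<mu> x. \<not> avoids (scheduled A m N) B)"
    using \<epsilon> by simp
  also have "\<dots> \<le> \<P>(B in bmp_law P \<nu> x. \<not> avoids (scheduled A m N) B)"
    by (rule prob_hit_gen_dominates[OF dom])
  also have "\<dots> \<le> measure (bmp_law P \<nu> x) ({B. io_beyond A m B} \<union>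
      {B. \<not> avoids (scheduled A m N) B \<and> \<not> io_beyond A m B})"
    by (intro N.finite_measure_mono) (auto intro!: sets_Collect_bmp_law sets.Un)
  also have "\<dots> \<le> measure (bmp_law P \<nu> x) {B. io_beyond A m B} +
      measure (bmp_law P \<nu> x) {B. \<not> avoids (scheduled A m N) B \<and> \<not> io_beyond A m B}"
    by (intro measure_Un_le) (auto intro!: sets_Collect_bmp_law)
  finally show "\<epsilon> * \<P>(B in bmp_law P \<mu> x. io_beyond A m B) \<le> \<P>(B in bmp_law P \<nu> x. io_beyond A m B) + \<delta>"
    using N by simp
qed

lemma prob_infinite_gen_dominates:
  fixes P :: "'s :: countable \<Rightarrow> 's pmf"
  assumes dom: "gen_dominates \<epsilon> \<mu> \<nu>"
  shows "\<epsilon> * \<P>(B in bmp_law P \<mu> x. \<forall>m. io_beyond A m B) \<le> \<P>(B in bmp_law P \<nu> x. \<forall>m. io_beyond A m B)"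
proof -
  have lim: "(\<lambda>m. \<P>(B in bmp_law P \<kappa> x. io_beyond A m B)) \<longlonglongrightarrow>
      \<P>(B in bmp_law P \<kappa> x. \<forall>m. io_beyond A m B)" for \<kappa>
  proof -
    interpret prob_space "bmp_law P \<kappa> x" by (rule prob_space_bmp_law)
    have "(\<lambda>m. prob {B\<in>space (bmp_law P \<kappa> x). io_beyond A m B}) \<longlonglongrightarrow>
        prob (\<Inter>m. {B\<in>space (bmp_law P \<kappa> x). io_beyond A m B})"
    proof (rule finite_Lim_measure_decseq)
      show "decseq (\<lambda>m. {B\<in>space (bmp_law P \<kappa> x). io_beyond A m B})"
        unfolding io_beyond_def by (rule decseq_SucI) (auto dest: Suc_leD)
    qed (auto intro!: sets_Collect_bmp_law)
    then show ?thesis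
      by (simp add: Collect_all_eq[symmetric])
  qed
  show ?thesis
    by (rule LIMSEQ_le[OF tendsto_mult[OF tendsto_const lim] lim])
      (intro exI[of _ 0] allI impI prob_io_beyond_gen_dominates[OF dom])
qed

section \<open>Survival\<close>

lemma avoid_prob_indep_start:
  assumes "\<And>j. D j = {} \<or> D j = UNIV"
  shows "avoid_prob P \<mu> D m x = avoid_prob P \<mu> D m y"
  using assms
proof (induction m arbitrary: D x y)
  case 0
  show ?case
    using "0"[of 0] by auto
next
  case (Suc m)
  have eq: "avoid_prob P \<mu> (\<lambda>j. D (Suc j)) m z = avoid_prob P \<mu> (\<lambda>j. D (Suc j)) m y" for z
    by (rule Suc.IH) (rule Suc.prems)
  have "(\<integral>\<^sup>+z. avoid_prob P \<mu> (\<lambda>j. D (Suc j)) m z \<partial>measure_pmf (P w)) =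
      avoid_prob P \<mu> (\<lambda>j. D (Suc j)) m y" for w
    by (subst nn_integral_cong[OF eq]) (simp add: measure_pmf.emeasure_space_1)
  then show ?case
    using Suc.prems[of 0] by auto
qed

lemma prob_alive_indep_start:
  fixes P :: "'s :: countable \<Rightarrow> 's pmf"
  shows "\<P>(B in bmp_law P \<mu> x. B n \<noteq> {#}) = \<P>(B in bmp_law P \<mu> y. B n \<noteq> {#})"
proof -
  define D where "D j = (if j = n then UNIV else {} :: 's set)" for j
  have D: "avoids D B \<longleftrightarrow> B n = {#}" for B
    by (auto simp: avoids_def D_def)
  have "measure (bmp_law P \<mu> z) {B. B n \<noteq> {#}} = 1 - measure (bmp_law P \<mu> z) {B. avoids D B}" for z
  proof -
    interpret prob_space "bmp_law P \<mu> z" by (rule prob_space_bmp_law)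
    show ?thesis
      using prob_neg[of "\<lambda>B. B n = {#}"] by (simp add: sets_Collect_bmp_law D)
  qed
  moreover have "emeasure (bmp_law P \<mu> x) {B. avoids D B} = emeasure (bmp_law P \<mu> y) {B. avoids D B}"
  proof (rule LIMSEQ_unique[OF avoid_prob_tendsto])
    have "avoid_prob P \<mu> D m x = avoid_prob P \<mu> D m y" for m
      by (rule avoid_prob_indep_start) (simp add: D_def)
    then show "(\<lambda>m. avoid_prob P \<mu> D m x) \<longlonglongrightarrow> emeasure (bmp_law P \<mu> y) {B. avoids D B}"
      by (simp add: avoid_prob_tendsto)
  qed
  ultimately show ?thesis
    by (simp add: measure_def)
qed

lemma survives_iff: "survives B \<longleftrightarrow> (\<forall>n. B n \<noteq> {#})"
  by (simp add: survives_def nonempty_has_size)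

lemma pred_survives [measurable]: "Measurable.pred (bmp_law P \<mu> x) survives"
  unfolding survives_def by measurable

text \<open>The number of particles is a Galton--Watson process, whatever the positions. Extinction is
  permanent only almost surely, which is where the law of the process enters the identification
  of \<open>survives\<close> as a decreasing limit of the events of being alive at time \<open>n\<close>.\<close>
lemma prob_survives_indep_start:
  fixes P :: "'s :: countable \<Rightarrow> 's pmf"
  shows "\<P>(B in bmp_law P \<mu> x. survives B) = \<P>(B in bmp_law P \<mu> y. survives B)"
proof -
  have lim: "(\<lambda>n. \<P>(B in bmp_law P \<mu> z. B n \<noteq> {#})) \<longlonglongrightarrow> \<P>(B in bmp_law P \<mu> z. survives B)" for z
  proof -
    interpret prob_space "bmp_law P \<mu> z" by (rule prob_space_bmp_law)
    let ?A = "\<lambda>n. {B :: nat \<Rightarrow> 's multiset. \<forall>k\<le>n. B k \<noteq> {#}}"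
    have meas: "?A n \<in> events" for n
      by (rule sets_Collect_bmp_law) measurable
    have "(\<lambda>n. prob (?A n)) \<longlonglongrightarrow> prob (\<Inter>n. ?A n)"
    proof (rule finite_Lim_measure_decseq)
      show "decseq ?A"
        by (rule decseq_SucI) (auto simp: le_Suc_eq)
    qed (use meas in auto)
    moreover have "(\<Inter>n. ?A n) = {B. survives B}"
      by (auto simp: survives_iff)
    moreover have "prob (?A n) = prob {B. B n \<noteq> {#}}" for n
    proof (rule finite_measure_eq_AE)
      have "AE B in bmp_law P \<mu> z. \<forall>k. B k = {#} \<longrightarrow> B (Suc k) = {#}"
        unfolding AE_all_countable using AE_bmp_law_extinct by blast
      then show "AE B in bmp_law P \<mu> z. B \<in> ?A n \<longleftrightarrow> B \<in> {B. B n \<noteq> {#}}"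
      proof eventually_elim
        case (elim B)
        have "B (k + j) = {#}" if "B k = {#}" for k j
          using that elim by (induction j) auto
        then have "B n = {#}" if "B k = {#}" "k \<le> n" for k
          using that le_Suc_ex by blast
        then show ?case
          by auto
      qed
    qed (use meas in \<open>auto intro!: sets_Collect_bmp_law pred_bmp_law_component\<close>)
    ultimately show ?thesis
      by (simp only: space_bmp_law UNIV_I simp_thms)
  qed
  have "(\<lambda>n. \<P>(B in bmp_law P \<mu> x. B n \<noteq> {#})) \<longlonglongrightarrow> \<P>(B in bmp_law P \<mu> y. survives B)"
    unfolding prob_alive_indep_start[of P \<mu> x _ y] by (rule lim)
  with lim[of x] show ?thesis
    by (rule LIMSEQ_unique)
qed

text \<open>Let \<open>a\<close> be the probability of surviving and avoiding \<open>D\<close>. By the Markov property at time \<open>k\<close>,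
  \<open>a\<close> is at most \<open>1 - c\<close> times the probability of being alive and having avoided \<open>D\<close> up to time
  \<open>k\<close>. The latter probability tends to \<open>a\<close>, so \<open>a \<le> (1 - c) a\<close> and \<open>a = 0\<close>.\<close>
lemma AE_survives_hits:
  fixes P :: "'s :: countable \<Rightarrow> 's pmf"
  assumes "c > 0" and hit: "\<And>k y. c \<le> \<P>(B in bmp_law P \<mu> y. \<not> avoids (\<lambda>j. D (k + j)) B)"
  shows "AE B in bmp_law P \<mu> x. survives B \<longrightarrow> \<not> avoids D B"
proof -
  interpret prob_space "bmp_law P \<mu> x" by (rule prob_space_bmp_law)
  let ?F = "\<lambda>k l. last l \<noteq> {#} \<and> (\<forall>i\<le>k. l ! i \<noteq> {#} \<and> set_mset (l ! i) \<inter> D i = {})"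
  let ?G = "\<lambda>k. {B. \<forall>i\<le>k. B i \<noteq> {#} \<and> set_mset (B i) \<inter> D i = {}}"
  let ?H = "{B. survives B \<and> avoids D B}"
  have F: "?F k (history k B) \<longleftrightarrow> B \<in> ?G k" for k B
    by auto
  have G: "?G k \<in> events" for k
    by (rule sets_Collect_bmp_law) measurable
  have H: "?H \<in> events"
    by (rule sets_Collect_bmp_law) measurable
  have le: "prob ?H \<le> (1 - c) * prob (?G k)" for k
  proof -
    let ?D = "\<lambda>j. D (k + j)"
    have c: "c \<le> 1"
      using order_trans[OF hit[of x 0] prob_le_1] .
    have avoid: "emeasure (bmp_law P \<mu> y) {B. avoids ?D B} \<le> ennreal (1 - c)" for y
    proof -
      interpret Y: prob_space "bmp_law P \<mu> y" by (rule prob_space_bmp_law)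
      have "Y.prob {B. avoids ?D B} \<le> 1 - c"
        using Y.prob_neg[of "avoids ?D"] hit[of y k] by (simp add: sets_Collect_bmp_law)
      then show ?thesis
        unfolding Y.emeasure_eq_measure by (rule ennreal_leI)
    qed
    \<comment> \<open>One particle is enough for the bound; the factors of the others are at most 1.\<close>
    have prod: "(\<Prod>y\<in>#M. emeasure (bmp_law P \<mu> y) {B. avoids ?D B}) \<le> ennreal (1 - c)" if nonempty: "M \<noteq> {#}" for M
    proof -
      obtain y M' where M: "M = add_mset y M'"
        using nonempty by (cases M) auto
      have "(\<Prod>y\<in>#M'. emeasure (bmp_law P \<mu> y) {B. avoids ?D B}) \<le> 1"
        by (induction M') (auto intro!: mult_le_one prob_space.emeasure_le_1[OF prob_space_bmp_law])
      then show ?thesis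
        unfolding M using mult_mono[OF avoid[of y], of _ 1] by simp
    qed
    have "emeasure (bmp_law P \<mu> x) ?H \<le>
        emeasure (bmp_law P \<mu> x) {B. ?F k (history k B) \<and> avoids ?D (\<lambda>j. B (k + j))}"
    proof (rule emeasure_mono)
      show "{B. ?F k (history k B) \<and> avoids ?D (\<lambda>j. B (k + j))} \<in> events"
        unfolding F mem_Collect_eq by (rule sets_Collect_bmp_law) measurable
    qed (auto simp: survives_iff avoids_def)
    also have "\<dots> = (\<integral>\<^sup>+B. of_bool (?F k (history k B)) *
        (\<Prod>y\<in>#B k. emeasure (bmp_law P \<mu> y) {B. avoids ?D B}) \<partial>bmp_law P \<mu> x)"
      by (rule emeasure_avoid_from)
    also have "\<dots> \<le> (\<integral>\<^sup>+B. ennreal (1 - c) * indicator (?G k) B \<partial>bmp_law P \<mu> x)"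
      unfolding F by (intro nn_integral_mono) (auto intro!: prod split: split_indicator)
    also have "\<dots> = ennreal (1 - c) * emeasure (bmp_law P \<mu> x) (?G k)"
      by (rule nn_integral_cmult_indicator[OF G])
    finally show ?thesis
      using c by (simp add: emeasure_eq_measure flip: ennreal_mult)
  qed
  have "(\<lambda>k. prob (?G k)) \<longlonglongrightarrow> prob (\<Inter>k. ?G k)"
  proof (rule finite_Lim_measure_decseq)
    show "decseq ?G"
      by (rule decseq_SucI) (auto simp: le_Suc_eq)
  qed (use G in auto)
  moreover have "(\<Inter>k. ?G k) = ?H"
    by (auto simp: survives_iff avoids_def)
  ultimately have "(\<lambda>k. (1 - c) * prob (?G k)) \<longlonglongrightarrow> (1 - c) * prob ?H"
    by (simp add: tendsto_mult_left)
  then have "prob ?H \<le> (1 - c) * prob ?H"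
    by (rule LIMSEQ_le_const) (use le in auto)
  then have "c * prob ?H \<le> 0"
    by (simp add: algebra_simps)
  then have "prob ?H = 0"
    using \<open>c > 0\<close> by (metis antisym measure_nonneg mult_le_0_iff not_less)
  then have "emeasure (bmp_law P \<mu> x) ?H = 0"
    by (simp add: emeasure_eq_measure)
  then show ?thesis
    using H by (intro AE_I[where N = ?H]) auto
qed

text \<open>The constant \<open>c\<close> below bounds the hitting probability for all schedules and all shifts at once,
  so the schedule may be chosen depending on the starting point \<open>x\<close> and on \<open>\<delta>\<close>.\<close>
lemma AE_survives_io_beyond:
  fixes P :: "'s :: countable \<Rightarrow> 's pmf"
  assumes dom: "gen_dominates \<epsilon> \<mu> \<nu>"
    and surv: "\<P>(B in bmp_law P \<mu> z. survives B) > 0"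
    and ae: "\<And>x. AE B in bmp_law P \<mu> x. survives B \<longrightarrow> io_beyond A m B"
  shows "AE B in bmp_law P \<nu> x. survives B \<longrightarrow> io_beyond A m B"
proof -
  interpret N: prob_space "bmp_law P \<nu> x" by (rule prob_space_bmp_law)
  define c where "c = \<epsilon> * \<P>(B in bmp_law P \<mu> z. survives B)"
  have \<epsilon>: "0 < \<epsilon>"
    using dom by (auto simp: gen_dominates_def)
  then have "c > 0"
    using surv by (simp add: c_def)
  have hit: "c \<le> \<P>(B in bmp_law P \<nu> y. \<not> avoids (\<lambda>j. scheduled A m N (k + j)) B)" for N k y
  proof -
    interpret M: prob_space "bmp_law P \<mu> y" by (rule prob_space_bmp_law)
    have "M.prob {B. survives B} \<le> M.prob {B. \<not> avoids (\<lambda>j. scheduled A m N (k + j)) B}"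
    proof (rule M.finite_measure_mono_AE)
      show "AE B in bmp_law P \<mu> y. B \<in> {B. survives B} \<longrightarrow>
          B \<in> {B. \<not> avoids (\<lambda>j. scheduled A m N (k + j)) B}"
        using ae[of y] by eventually_elim (auto dest: io_beyond_hits_scheduled)
      show "{B. \<not> avoids (\<lambda>j. scheduled A m N (k + j)) B} \<in> M.events"
        by (rule sets_Collect_bmp_law) measurable
    qed
    then have "c \<le> \<epsilon> * M.prob {B. \<not> avoids (\<lambda>j. scheduled A m N (k + j)) B}"
      using \<epsilon> prob_survives_indep_start[of P \<mu> z y] by (simp add: c_def)
    also have "\<dots> \<le> \<P>(B in bmp_law P \<nu> y. \<not> avoids (\<lambda>j. scheduled A m N (k + j)) B)"
      using prob_hit_gen_dominates[OF dom, of P y "\<lambda>j. scheduled A m N (k + j)"] by simp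
    finally show ?thesis .
  qed
  let ?E = "{B. survives B \<and> \<not> io_beyond A m B}"
  have E: "?E \<in> N.events"
    by (rule sets_Collect_bmp_law) measurable
  have "N.prob ?E \<le> 0 + \<delta>" if "\<delta> > 0" for \<delta> :: real
  proof -
    obtain N where N: "N.prob {B. \<not> avoids (scheduled A m N) B \<and> \<not> io_beyond A m B} \<le> \<delta>"
      using N.choose_schedule[where X = "\<lambda>B. B" and A = A and m = m, OF _ \<open>\<delta> > 0\<close>] by auto
    have "AE B in bmp_law P \<nu> x. survives B \<longrightarrow> \<not> avoids (scheduled A m N) B"
      by (rule AE_survives_hits[OF \<open>c > 0\<close> hit])
    then have "N.prob ?E \<le> N.prob {B. \<not> avoids (scheduled A m N) B \<and> \<not> io_beyond A m B}"
    proof (intro N.finite_measure_mono_AE)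
      show "{B. \<not> avoids (scheduled A m N) B \<and> \<not> io_beyond A m B} \<in> N.events"
        by (rule sets_Collect_bmp_law) measurable
    qed auto
    with N show ?thesis
      by simp
  qed
  then have "N.prob ?E \<le> 0"
    by (rule field_le_epsilon)
  then have "emeasure (bmp_law P \<nu> x) ?E = 0"
    by (simp add: N.emeasure_eq_measure measure_le_0_iff)
  then show ?thesis
    using E by (intro AE_I[where N = ?E]) auto
qed

section \<open>The comparison theorem\<close>

theorem theorem1p5:
  fixes P :: "'s::countable \<Rightarrow> 's pmf"
    and I :: "'i set" and A :: "'i \<Rightarrow> 's set"
    and \<mu> \<nu> :: "nat pmf"
  assumes "countable I"
    and "offspring_measure \<mu> \<le>\<^sub>g\<^sub>e\<^sub>r\<^sub>m offspring_measure \<nu>"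
  shows
    "((\<exists>x. \<P>(B in bmp_law P \<mu> x. survives B) > 0) \<longrightarrow>
      (\<forall>x. AE B in bmp_law P \<mu> x. survives B \<longrightarrow> infinite (I_infty I A B)) \<longrightarrow>
      (\<forall>x. AE B in bmp_law P \<nu> x. survives B \<longrightarrow> infinite (I_infty I A B))) \<and>
     ((\<forall>x. AE B in bmp_law P \<nu> x. finite (I_infty I A B)) \<longrightarrow>
      (\<forall>x. AE B in bmp_law P \<mu> x. finite (I_infty I A B)))"
proof -
  obtain A' :: "nat \<Rightarrow> 's set" where A': "\<And>B. infinite (I_infty I A B) \<longleftrightarrow> (\<forall>m. io_beyond A' m B)"
    using infinite_I_infty_iff[OF assms(1)] by blast
  then have fin: "finite (I_infty I A B) \<longleftrightarrow> \<not> (\<forall>m. io_beyond A' m B)" for B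
    by blast
  obtain \<epsilon> where dom: "gen_dominates \<epsilon> \<mu> \<nu>"
    using germ_le_imp_gen_dominates[OF assms(2)] by blast
  show ?thesis
    unfolding fin not_not
  proof (intro conjI impI allI)
    fix x
    assume "\<exists>x. \<P>(B in bmp_law P \<mu> x. survives B) > 0"
      and ae: "\<forall>x. AE B in bmp_law P \<mu> x. survives B \<longrightarrow> (\<forall>m. io_beyond A' m B)"
    then obtain z where z: "\<P>(B in bmp_law P \<mu> z. survives B) > 0"
      by blast
    have "AE B in bmp_law P \<nu> x. survives B \<longrightarrow> io_beyond A' m B" for m
    proof (rule AE_survives_io_beyond[OF dom z])
      show "AE B in bmp_law P \<mu> y. survives B \<longrightarrow> io_beyond A' m B" for y
        using ae[rule_format, of y] by eventually_elim blast
    qed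
    then have "AE B in bmp_law P \<nu> x. \<forall>m. survives B \<longrightarrow> io_beyond A' m B"
      unfolding AE_all_countable by blast
    then show "AE B in bmp_law P \<nu> x. survives B \<longrightarrow> (\<forall>m. io_beyond A' m B)"
      by eventually_elim blast
  next
    fix x
    assume ae: "\<forall>x. AE B in bmp_law P \<nu> x. \<not> (\<forall>m. io_beyond A' m B)"
    interpret M: prob_space "bmp_law P \<mu> x" by (rule prob_space_bmp_law)
    interpret N: prob_space "bmp_law P \<nu> x" by (rule prob_space_bmp_law)
    have meas: "{B. \<forall>m. io_beyond A' m B} \<in> sets (bmp_law P \<kappa> x)" for \<kappa>
      by (rule sets_Collect_bmp_law) measurable
    have "N.prob {B. \<forall>m. io_beyond A' m B} = 0"
      using ae[rule_format, of x] N.prob_eq_0[OF meas] by simp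
    then have "\<epsilon> * M.prob {B. \<forall>m. io_beyond A' m B} \<le> 0"
      using prob_infinite_gen_dominates[OF dom, of P x A'] by simp
    then have "M.prob {B. \<forall>m. io_beyond A' m B} = 0"
      using dom measure_nonneg[of "bmp_law P \<mu> x" "{B. \<forall>m. io_beyond A' m B}"]
      by (auto simp: gen_dominates_def mult_le_0_iff)
    then show "AE B in bmp_law P \<mu> x. \<not> (\<forall>m. io_beyond A' m B)"
      using M.prob_eq_0[OF meas] by simp
  qed
qed

end
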